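(* Suppose that for some $\Omega_X,\Omega_Y>0$, $$\sup_{x_1,x_2\in X}V_X(x_1,x_2)\le \Omega_X^2\quad\text{and}\quad \sup_{y_1,y_2\in Y}V_Y(y_1,y_2)\le\Omega_Y^2 .$$ Assume that the parameters $\beta_t,\theta_t,\eta_t,\tau_t$ of the accelerated primal-dual (APD) algorithm described in the context satisfy $\beta_1=1$ and, for all $t\ge 1$ (the second condition for all $t\ge2$), $$\beta_{t+1}-1=\beta_t\theta_{t+1},$$ $$0<\theta_t\le\min\left\{\frac{\eta_{t-1}}{\eta_t},\frac{\tau_{t-1}}{\tau_t}\right\},$$ $$\frac{\alpha_X}{\eta_t}-\frac{L_G}{\beta_t}-\frac{L_K^2\tau_t}{\alpha_Y}\ge 0 .$$ Then for all $t\ge1$ the iterates $z_{t+1}^{ag}=(x_{t+1}^{ag},y_{t+1}^{ag})$ satisfy $$g(z_{t+1}^{ag})\le\frac{1}{\beta_t\eta_t}\Omega_X^2+\frac{1}{\beta_t\tau_t}\Omega_Y^2 .$$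
   Context: Setting. $\mathcal X,\mathcal Y$ are finite-dimensional real vector spaces, each equipped with an inner product $\langle\cdot,\cdot\rangle$ and a norm $\|\cdot\|$, with dual norm $\|\cdot\|_*$; $X\subseteq\mathcal X$, $Y\subseteq\mathcal Y$ are closed convex sets and $Z=X\times Y$. $G$ is a smooth convex function with $G(y)-G(x)-\langle\nabla G(x),y-x\rangle\le\frac{L_G}{2}\|y-x\|^2$ for all $x,y\in X$, for some $L_G\ge0$. $K:\mathcal X\to\mathcal Y$ is linear with transpose $K^T$ and induced norm $L_K=\|K\|$ (so $\|Kx\|_*\le L_K\|x\|$ and $\langle Kx,y\rangle\le L_K\|x\|\|y\|$). $J:Y\to\mathbb R$ is proper, convex and lower semicontinuous. The saddle point problem is $\min_{x\in X}\max_{y\in Y}G(x)+\langle Kx,y\rangle-J(y)$. Bregman divergences: $V_X(x,u)=d_X(x)-d_X(u)-\langle\nabla d_X(u),x-u\rangle$ and $V_Y(y,v)=d_Y(y)-d_Y(v)-\langle\nabla d_Y(v),y-v\rangle$, where $d_X$, $d_Y$ are strongly convex (differentiable) functions with strong convexity parameters $\alpha_X,\alpha_Y>0$ with respect to the given norms. APD algorithm. Choose $x_1\in X$, $y_1\in Y$; set $x_1^{ag}=x_1$, $y_1^{ag}=y_1$, $\bar x_1=x_1$. With positive stepsizes $\eta_t,\tau_t$, for $t=1,2,\dots$: $x_t^{md}=(1-\beta_t^{-1})x_t^{ag}+\beta_t^{-1}x_t$; $y_{t+1}=\operatorname{argmin}_{y\in Y}\langle-K\bar x_t,y\rangle+J(y)+\frac1{\tau_t}V_Y(y,y_t)$;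 $x_{t+1}=\operatorname{argmin}_{x\in X}\langle\nabla G(x_t^{md}),x\rangle+\langle x,K^Ty_{t+1}\rangle+\frac1{\eta_t}V_X(x,x_t)$; $x_{t+1}^{ag}=(1-\beta_t^{-1})x_t^{ag}+\beta_t^{-1}x_{t+1}$; $y_{t+1}^{ag}=(1-\beta_t^{-1})y_t^{ag}+\beta_t^{-1}y_{t+1}$; $\bar x_{t+1}=\theta_{t+1}(x_{t+1}-x_t)+x_{t+1}$. Gap function. For $\tilde z=(\tilde x,\tilde y)$, $z=(x,y)\in Z$: $Q(\tilde z,z)=[G(\tilde x)+\langle K\tilde x,y\rangle-J(y)]-[G(x)+\langle Kx,\tilde y\rangle-J(\tilde y)]$, and $g(\tilde z)=\max_{z\in Z}Q(\tilde z,z)$ (understood as a supremum). *)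

theory Defs
  imports "HOL-Analysis.Analysis"
begin

text \<open>
  The ambient spaces are Euclidean spaces: the type class supplies the inner product, whereas the
  norms of the saddle point problem are arbitrary and in general not induced by it. They are
  therefore functions \<open>N\<close> satisfying the following predicate. In finite dimension all norms induce
  the topology of the type class, so \<open>closed\<close>, lower semicontinuity and derivatives are not affected.
\<close>

definition is_norm :: "('a::real_vector \<Rightarrow> real) \<Rightarrow> bool" where
  "is_norm N \<longleftrightarrow>
     (\<forall>x. 0 \<le> N x) \<and> (\<forall>x. N x = 0 \<longleftrightarrow> x = 0) \<and>
     (\<forall>c x. N (c *\<^sub>R x) = \<bar>c\<bar> * N x) \<and> (\<forall>x y. N (x + y) \<le> N x + N y)"

definition dual_norm :: "('a::euclidean_space \<Rightarrow> real) \<Rightarrow> 'a \<Rightarrow> real" where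
  "dual_norm N g = (SUP x\<in>{x. N x \<le> 1}. g \<bullet> x)"

definition induced_norm ::
  "('a::euclidean_space \<Rightarrow> real) \<Rightarrow> ('b::euclidean_space \<Rightarrow> real) \<Rightarrow> ('a \<Rightarrow> 'b) \<Rightarrow> real" where
  "induced_norm NX NY K = (SUP x\<in>{x. NX x \<le> 1}. dual_norm NY (K x))"

text \<open>
  Functions are given on \<open>S\<close> only, so the derivative is taken within \<open>S\<close>; if \<open>f\<close> is differentiable
  in the ambient space, its gradient is an instance. If \<open>S\<close> has empty interior, \<open>f'\<close> need not be
  unique. For convex \<open>S\<close> and \<open>x, y \<in> S\<close>, however, \<open>f' x \<bullet> (y - x)\<close> is the derivative of \<open>f\<close>
  along a segment in \<open>S\<close>, and gradients enter below only through such terms (up to a constant in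
  the objectives that are minimised).
\<close>

definition gradient_on :: "'a::real_inner set \<Rightarrow> ('a \<Rightarrow> real) \<Rightarrow> ('a \<Rightarrow> 'a) \<Rightarrow> bool" where
  "gradient_on S f f' \<longleftrightarrow> (\<forall>x\<in>S. (f has_derivative (\<lambda>h. f' x \<bullet> h)) (at x within S))"

definition strongly_convex_on ::
  "real \<Rightarrow> ('a::real_vector \<Rightarrow> real) \<Rightarrow> 'a set \<Rightarrow> ('a \<Rightarrow> real) \<Rightarrow> bool" where
  "strongly_convex_on \<alpha> N S d \<longleftrightarrow> convex S \<and>
     (\<forall>x\<in>S. \<forall>y\<in>S. \<forall>u\<ge>0. \<forall>v\<ge>0. u + v = 1 \<longrightarrow>
        d (u *\<^sub>R x + v *\<^sub>R y) \<le> u * d x + v * d y - \<alpha> / 2 * u * v * (N (x - y))\<^sup>2)"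

definition lower_semicontinuous_on :: "'a::topological_space set \<Rightarrow> ('a \<Rightarrow> real) \<Rightarrow> bool" where
  "lower_semicontinuous_on S f \<longleftrightarrow> (\<forall>x\<in>S. \<forall>c. c < f x \<longrightarrow> (\<forall>\<^sub>F y in at x within S. c < f y))"

text \<open>For a real-valued function on \<open>S\<close>, properness means that \<open>S\<close>, its domain, is nonempty.\<close>

definition proper_convex_lsc_on :: "'a::real_normed_vector set \<Rightarrow> ('a \<Rightarrow> real) \<Rightarrow> bool" where
  "proper_convex_lsc_on S f \<longleftrightarrow> S \<noteq> {} \<and> convex_on S f \<and> lower_semicontinuous_on S f"

definition bregman :: "('a::real_inner \<Rightarrow> real) \<Rightarrow> ('a \<Rightarrow> 'a) \<Rightarrow> 'a \<Rightarrow> 'a \<Rightarrow> real" where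
  "bregman d d' x u = d x - d u - d' u \<bullet> (x - u)"

definition saddle_Q ::
  "('a::real_inner \<Rightarrow> real) \<Rightarrow> ('a \<Rightarrow> 'b::real_inner) \<Rightarrow> ('b \<Rightarrow> real) \<Rightarrow> 'a \<times> 'b \<Rightarrow> 'a \<times> 'b \<Rightarrow> real" where
  "saddle_Q G K J zt z =
     (G (fst zt) + K (fst zt) \<bullet> snd z - J (snd z)) -
     (G (fst z) + K (fst z) \<bullet> snd zt - J (snd zt))"

text \<open>Suprema that may be infinite a priori are taken in the extended reals.\<close>

definition gap ::
  "'a::real_inner set \<Rightarrow> 'b::real_inner set \<Rightarrow> ('a \<Rightarrow> real) \<Rightarrow> ('a \<Rightarrow> 'b) \<Rightarrow> ('b \<Rightarrow> real) \<Rightarrow> 'a \<times> 'b \<Rightarrow> ereal"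
  where "gap X Y G K J zt = (SUP z\<in>X \<times> Y. ereal (saddle_Q G K J zt z))"

end

theory Submission
  imports Defs
begin

text \<open>
  Fix a comparison point \<open>(u, v)\<close> and let \<open>q\<^sub>t\<close> be the value of \<open>Q\<close> at the aggregated iterate
  of index \<open>t\<close> against it. One iteration bounds \<open>\<beta>\<^sub>t q\<^sub>t\<^sub>+\<^sub>1 - (\<beta>\<^sub>t - 1) q\<^sub>t\<close>. The aggregation rule,
  convexity and the smoothness of \<open>G\<close> reduce this difference to terms at the new iterates
  \<open>x\<^sub>t\<^sub>+\<^sub>1\<close>, \<open>y\<^sub>t\<^sub>+\<^sub>1\<close>, up to an error \<open>L\<^sub>G / (2 \<beta>\<^sub>t) \<parallel>x\<^sub>t\<^sub>+\<^sub>1 - x\<^sub>t\<parallel>\<^sup>2\<close>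
  (\<open>saddle_Q_aggregate_step\<close>). The optimality conditions of the two proximal steps
  (\<open>prox_three_point\<close>) bound these terms by decreases of the Bregman distances to \<open>(u, v)\<close>, minus
  the Bregman lengths of the steps, which are at least quadratic by strong convexity
  (\<open>strongly_convex_bregman_ge\<close>).

  What remains is the coupling \<open>- \<langle>K(x\<^sub>t\<^sub>+\<^sub>1 - \<xi>\<^sub>t), y\<^sub>t\<^sub>+\<^sub>1 - v\<rangle>\<close>, where \<open>\<xi>\<^sub>t\<close> is the extrapolated
  point. Put \<open>C\<^sub>t = \<langle>K(x\<^sub>t\<^sub>+\<^sub>1 - x\<^sub>t), y\<^sub>t\<^sub>+\<^sub>1 - v\<rangle>\<close>. For \<open>t = 1\<close> the coupling is \<open>- C\<^sub>1\<close>, and for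
  \<open>t \<ge> 2\<close> the extrapolation makes it nearly telescope: it equals
  \<open>- C\<^sub>t + \<theta>\<^sub>t C\<^sub>t\<^sub>-\<^sub>1 + \<theta>\<^sub>t \<langle>K(x\<^sub>t - x\<^sub>t\<^sub>-\<^sub>1), y\<^sub>t\<^sub>+\<^sub>1 - y\<^sub>t\<rangle>\<close>. Young's inequality
  (\<open>coupling_young\<close>) charges the last term to the current dual step and to the previous primal
  step. Because \<open>\<theta>\<^sub>t \<tau>\<^sub>t \<le> \<tau>\<^sub>t\<^sub>-\<^sub>1\<close>, the stepsize condition at \<open>t - 1\<close> lets the previous primal step
  pay for this together with the smoothness error.

  Since \<open>\<beta>\<^sub>t - 1 = \<theta>\<^sub>t \<beta>\<^sub>t\<^sub>-\<^sub>1\<close> for \<open>t \<ge> 2\<close> and \<open>\<beta>\<^sub>1 - 1 = 0\<close>, the one-step bounds chain. Rather than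
  summing them with weights, the proof carries by induction the invariant
  \<open>\<beta>\<^sub>t q\<^sub>t\<^sub>+\<^sub>1 \<le> (\<Omega>\<^sub>X\<^sup>2 - V\<^sub>X(u, x\<^sub>t\<^sub>+\<^sub>1)) / \<eta>\<^sub>t + (\<Omega>\<^sub>Y\<^sup>2 - V\<^sub>Y(v, y\<^sub>t\<^sub>+\<^sub>1)) / \<tau>\<^sub>t - C\<^sub>t
    - (\<alpha>\<^sub>X / (2 \<eta>\<^sub>t) - L\<^sub>G / (2 \<beta>\<^sub>t)) \<parallel>x\<^sub>t\<^sub>+\<^sub>1 - x\<^sub>t\<parallel>\<^sup>2\<close>.
  At the end Young's inequality absorbs \<open>- C\<^sub>t\<close> into \<open>V\<^sub>Y(v, y\<^sub>t\<^sub>+\<^sub>1)\<close> and the quadratic term, and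
  the supremum over \<open>(u, v)\<close> gives the gap.
\<close>

section \<open>The induced norm bounds the bilinear coupling\<close>

lemma is_normD:
  assumes "is_norm N"
  shows is_norm_nonneg: "0 \<le> N x"
    and is_norm_eq_0_iff: "N x = 0 \<longleftrightarrow> x = 0"
    and is_norm_scaleR: "N (c *\<^sub>R x) = \<bar>c\<bar> * N x"
    and is_norm_triangle: "N (x + y) \<le> N x + N y"
  using assms by (auto simp: is_norm_def)

lemma is_norm_pos:
  assumes "is_norm N" "x \<noteq> 0"
  shows "0 < N x"
  using is_norm_nonneg[OF assms(1), of x] is_norm_eq_0_iff[OF assms(1), of x] assms(2) by simp

lemma is_norm_convex:
  fixes N :: "'a::real_vector \<Rightarrow> real"
  assumes "is_norm N"
  shows "convex_on UNIV N"
proof (rule convex_onI)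
  fix t :: real and x y :: 'a
  assume t: "0 < t" "t < 1"
  have "N ((1 - t) *\<^sub>R x + t *\<^sub>R y) \<le> N ((1 - t) *\<^sub>R x) + N (t *\<^sub>R y)"
    using assms by (rule is_norm_triangle)
  also have "\<dots> = (1 - t) * N x + t * N y"
    using t by (simp add: is_norm_scaleR[OF assms])
  finally show "N ((1 - t) *\<^sub>R x + t *\<^sub>R y) \<le> (1 - t) * N x + t * N y" .
qed simp

lemma is_norm_dominates_norm:
  fixes N :: "'a::euclidean_space \<Rightarrow> real"
  assumes N: "is_norm N"
  obtains c where "0 < c" "\<And>x. norm x \<le> c * N x"
proof -
  have cont: "continuous_on (sphere 0 1) N"
    using convex_on_continuous[OF open_UNIV is_norm_convex[OF N]]
    by (rule continuous_on_subset) simp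
  have "sphere (0::'a) 1 \<noteq> {}"
    by simp
  then obtain m where m: "m \<in> sphere 0 1" "\<And>x. x \<in> sphere 0 1 \<Longrightarrow> N m \<le> N x"
    using continuous_attains_inf[OF compact_sphere _ cont] by blast
  have pos: "0 < N m"
    using m(1) by (intro is_norm_pos[OF N]) auto
  have "norm x \<le> (1 / N m) * N x" for x
  proof (cases "x = 0")
    case True
    then show ?thesis
      using pos by (simp add: is_norm_nonneg[OF N])
  next
    case False
    then have "N m \<le> N ((1 / norm x) *\<^sub>R x)"
      by (intro m(2)) simp
    also have "\<dots> = N x / norm x"
      by (simp add: is_norm_scaleR[OF N])
    finally show ?thesis
      using False pos by (simp add: field_simps)
  qed
  with pos show thesis
    by (intro that[of "1 / N m"]) auto
qed

lemma is_norm_bound_by_unit_ball: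
  fixes N :: "'a::real_vector \<Rightarrow> real"
  assumes N: "is_norm N" and hom: "\<And>c x. 0 \<le> c \<Longrightarrow> f (c *\<^sub>R x) = c * f x"
    and le: "\<And>x. N x \<le> 1 \<Longrightarrow> f x \<le> B"
  shows "f x \<le> B * N x"
proof (cases "x = 0")
  case True
  then show ?thesis
    using hom[of 0 0] is_norm_eq_0_iff[OF N, of 0] by simp
next
  case False
  then have pos: "0 < N x"
    by (rule is_norm_pos[OF N])
  have "f ((1 / N x) *\<^sub>R x) \<le> B"
    using pos by (intro le) (simp add: is_norm_scaleR[OF N])
  then show ?thesis
    using pos by (simp add: hom field_simps)
qed

lemma dual_norm_bounds:
  fixes N :: "'a::euclidean_space \<Rightarrow> real"
  assumes N: "is_norm N"
  obtains c where "0 < c" "\<And>g. dual_norm N g \<le> c * norm g"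
    "\<And>g x. g \<bullet> x \<le> dual_norm N g * N x"
proof -
  obtain c where c: "0 < c" "\<And>x. norm x \<le> c * N x"
    using is_norm_dominates_norm[OF N] by blast
  have le: "g \<bullet> x \<le> c * norm g" if "N x \<le> 1" for g x
  proof -
    have "g \<bullet> x \<le> norm g * norm x"
      by (rule norm_cauchy_schwarz)
    also have "\<dots> \<le> norm g * c"
      using order_trans[OF c(2)[of x] mult_left_le[OF that]] c(1) by (intro mult_left_mono) auto
    finally show ?thesis
      by (simp add: mult.commute)
  qed
  have ne: "{x. N x \<le> 1} \<noteq> {}"
    using is_norm_eq_0_iff[OF N, of 0] by (auto intro!: exI[of _ 0])
  have "dual_norm N g \<le> c * norm g" for g
    unfolding dual_norm_def using ne le by (intro cSUP_least) auto
  moreover have "g \<bullet> x \<le> dual_norm N g * N x" for g x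
  proof (rule is_norm_bound_by_unit_ball[OF N])
    fix x assume "N x \<le> 1"
    then show "g \<bullet> x \<le> dual_norm N g"
      unfolding dual_norm_def using le by (intro cSUP_upper bdd_aboveI2[of _ _ "c * norm g"]) auto
  qed simp
  ultimately show thesis
    using c(1) that by blast
qed

text \<open>
  The suprema defining the induced norm are over bounded sets of reals because, in finite
  dimension, the unit ball of any norm is bounded for the Euclidean norm.
\<close>
lemma induced_norm_bilinear_bound:
  fixes K :: "'a::euclidean_space \<Rightarrow> 'b::euclidean_space"
  assumes NX: "is_norm NX" and NY: "is_norm NY" and K: "linear K"
  shows "K x \<bullet> y \<le> induced_norm NX NY K * NX x * NY y"
proof -
  obtain c where c: "0 < c" "\<And>x. norm x \<le> c * NX x"
    using is_norm_dominates_norm[OF NX] by blast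
  obtain e where e: "0 < e" "\<And>g. dual_norm NY g \<le> e * norm g"
    "\<And>g y. g \<bullet> y \<le> dual_norm NY g * NY y"
    using dual_norm_bounds[OF NY] by blast
  obtain k where k: "0 < k" "\<And>x. norm (K x) \<le> k * norm x"
    using linear_bounded_pos[OF K] by (metis mult.commute)
  have bdd: "bdd_above ((\<lambda>x. dual_norm NY (K x)) ` {x. NX x \<le> 1})"
  proof (rule bdd_aboveI2)
    fix x assume "x \<in> {x. NX x \<le> 1}"
    then have "norm x \<le> c"
      using order_trans[OF c(2)[of x] mult_left_le[of "NX x" c]] c(1) by simp
    then have "norm (K x) \<le> k * c"
      using order_trans[OF k(2)[of x] mult_left_mono[of "norm x" c k]] k(1) by simp
    then show "dual_norm NY (K x) \<le> e * (k * c)"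
      using order_trans[OF e(2)[of "K x"] mult_left_mono[of "norm (K x)" "k * c" e]] e(1) by simp
  qed
  have unit: "K x \<bullet> y \<le> induced_norm NX NY K * NY y" if "NX x \<le> 1" for x
  proof -
    have "dual_norm NY (K x) \<le> induced_norm NX NY K"
      unfolding induced_norm_def using bdd that by (intro cSUP_upper) auto
    then have "dual_norm NY (K x) * NY y \<le> induced_norm NX NY K * NY y"
      by (intro mult_right_mono is_norm_nonneg[OF NY])
    with e(3)[of "K x" y] show ?thesis
      by linarith
  qed
  have "K x \<bullet> y \<le> (induced_norm NX NY K * NY y) * NX x"
    by (rule is_norm_bound_by_unit_ball[OF NX _ unit]) (simp add: linear_scale[OF K])
  then show ?thesis
    by (simp add: mult_ac)
qed

text \<open>
  Young's inequality splits the coupling into the squared step lengths, weighted so that the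
  dual part is exactly what the dual Bregman term with stepsize \<open>t\<close> absorbs.
\<close>
lemma coupling_young:
  fixes K :: "'a::euclidean_space \<Rightarrow> 'b::euclidean_space"
  assumes "is_norm NX" "is_norm NY" "linear K" and pos: "0 < \<alpha>" "0 < t"
  shows "c * (K x \<bullet> y) \<le>
    c\<^sup>2 * ((induced_norm NX NY K)\<^sup>2 * t / (2 * \<alpha>)) * (NX x)\<^sup>2 + \<alpha> / (2 * t) * (NY y)\<^sup>2"
proof -
  define L where "L = induced_norm NX NY K"
  have sc: "NX (c *\<^sub>R x) = \<bar>c\<bar> * NX x"
    by (rule is_norm_scaleR[OF assms(1)])
  have "c * (K x \<bullet> y) = K (c *\<^sub>R x) \<bullet> y"
    by (simp add: linear_scale[OF assms(3)])
  also have "\<dots> \<le> L * NX (c *\<^sub>R x) * NY y"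
    unfolding L_def by (rule induced_norm_bilinear_bound[OF assms(1-3)])
  also have "\<dots> \<le> (L * NX (c *\<^sub>R x))\<^sup>2 * t / (2 * \<alpha>) + \<alpha> / (2 * t) * (NY y)\<^sup>2"
  proof -
    have "0 \<le> (t * (L * NX (c *\<^sub>R x)) - \<alpha> * NY y)\<^sup>2 / (2 * \<alpha> * t)"
      using pos by simp
    also have "\<dots> = (L * NX (c *\<^sub>R x))\<^sup>2 * t / (2 * \<alpha>) + \<alpha> / (2 * t) * (NY y)\<^sup>2
        - L * NX (c *\<^sub>R x) * NY y"
      using pos by (simp add: power2_eq_square field_simps)
    finally show ?thesis
      by simp
  qed
  finally show ?thesis
    by (simp add: sc L_def power_mult_distrib mult_ac)
qed

section \<open>Bregman divergences and proximal steps\<close>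

lemma gradient_on_directional_limit:
  fixes f :: "'a::real_inner \<Rightarrow> real"
  assumes grad: "gradient_on S f f'" and S: "convex S" "x \<in> S" "y \<in> S"
  shows "((\<lambda>s. (f (x + s *\<^sub>R (y - x)) - f x) / s) \<longlongrightarrow> f' x \<bullet> (y - x)) (at_right 0)"
proof -
  define p where "p s = x + s *\<^sub>R (y - x)" for s :: real
  have p_in: "p ` {0..1} \<subseteq> S"
  proof
    fix z assume "z \<in> p ` {0..1}"
    then obtain s where s: "0 \<le> s" "s \<le> 1" "z = (1 - s) *\<^sub>R x + s *\<^sub>R y"
      by (auto simp: p_def algebra_simps)
    then show "z \<in> S"
      using convexD[OF S(1-3), of "1 - s" s] by simp
  qed
  have p0: "p 0 = x"
    by (simp add: p_def)
  have "(f has_derivative (\<lambda>h. f' x \<bullet> h)) (at (p 0) within S)"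
    using grad S(2) by (simp add: gradient_on_def p0)
  then have f: "(f has_derivative (\<lambda>h. f' x \<bullet> h)) (at (p 0) within p ` {0..1})"
    using p_in by (rule has_derivative_subset)
  have "(p has_derivative (\<lambda>s. s *\<^sub>R (y - x))) (at 0 within {0..1})"
    unfolding p_def by (auto intro!: derivative_eq_intros)
  from has_derivative_in_compose[OF this f]
  have "((\<lambda>s. f (p s)) has_derivative (\<lambda>s. f' x \<bullet> (s *\<^sub>R (y - x)))) (at 0 within {0..1})" .
  then have "((\<lambda>s. f (p s)) has_field_derivative f' x \<bullet> (y - x)) (at 0 within {0..1})"
    by (simp add: has_field_derivative_def mult_commute_abs)
  then show ?thesis
    by (simp add: has_field_derivative_iff p0 at_within_Icc_at_right) (simp add: p_def)
qed

lemma eventually_at_right_0_less_1: "\<forall>\<^sub>F s::real in at_right 0. 0 < s \<and> s < 1"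
  by (auto simp: eventually_at_right_field intro!: exI[of _ 1])

text \<open>
  Dividing the strong convexity inequality on a segment by its parameter and letting the
  parameter tend to zero turns the chord into the tangent.
\<close>
lemma strongly_convex_bregman_ge:
  fixes d :: "'a::real_inner \<Rightarrow> real"
  assumes grad: "gradient_on S d d'" and sc: "strongly_convex_on \<alpha> N S d"
    and in_S: "x \<in> S" "u \<in> S"
  shows "\<alpha> / 2 * (N (x - u))\<^sup>2 \<le> bregman d d' x u"
proof -
  have cS: "convex S"
    using sc by (simp add: strongly_convex_on_def)
  have "d' u \<bullet> (x - u) \<le> d x - d u - \<alpha> / 2 * (1 - 0) * (N (x - u))\<^sup>2"
  proof (rule tendsto_le[OF _ _ gradient_on_directional_limit[OF grad cS in_S(2,1)]])
    show "((\<lambda>s. d x - d u - \<alpha> / 2 * (1 - s) * (N (x - u))\<^sup>2)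
        \<longlongrightarrow> d x - d u - \<alpha> / 2 * (1 - 0) * (N (x - u))\<^sup>2) (at_right 0)"
      by (intro tendsto_intros)
    show "\<forall>\<^sub>F s in at_right 0. (d (u + s *\<^sub>R (x - u)) - d u) / s
        \<le> d x - d u - \<alpha> / 2 * (1 - s) * (N (x - u))\<^sup>2"
      using eventually_at_right_0_less_1
    proof eventually_elim
      case (elim s)
      have "d (s *\<^sub>R x + (1 - s) *\<^sub>R u) \<le>
          s * d x + (1 - s) * d u - \<alpha> / 2 * s * (1 - s) * (N (x - u))\<^sup>2"
        using sc in_S elim unfolding strongly_convex_on_def by auto
      moreover have "s *\<^sub>R x + (1 - s) *\<^sub>R u = u + s *\<^sub>R (x - u)"
        by (simp add: algebra_simps)
      ultimately have "d (u + s *\<^sub>R (x - u)) - d u \<le>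
          s * (d x - d u - \<alpha> / 2 * (1 - s) * (N (x - u))\<^sup>2)"
        by (simp add: algebra_simps)
      with elim show ?case
        by (simp add: divide_le_eq mult.commute)
    qed
  qed simp
  then show ?thesis
    by (simp add: bregman_def)
qed

lemma convex_above_tangent:
  fixes f :: "'a::real_inner \<Rightarrow> real"
  assumes "gradient_on S f f'" "convex S" "convex_on S f" "x \<in> S" "u \<in> S"
  shows "f u + f' u \<bullet> (x - u) \<le> f x"
proof -
  have "strongly_convex_on 0 norm S f"
    using assms(2,3) by (auto simp: strongly_convex_on_def convex_on_def)
  from strongly_convex_bregman_ge[OF assms(1) this assms(4,5)] show ?thesis
    by (simp add: bregman_def)
qed

text \<open>
  Moving from the minimiser \<open>p\<close> a little towards \<open>v\<close> cannot decrease the objective. To first order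
  this says that \<open>\<phi> p - \<phi> v\<close> is at most \<open>(d' p - d' u) \<bullet> (v - p) / t\<close>, and that
  inner product is a combination of three Bregman divergences.
\<close>
lemma prox_three_point:
  fixes d :: "'a::real_inner \<Rightarrow> real"
  assumes grad: "gradient_on S d d'" and S: "convex S" and \<phi>: "convex_on S \<phi>" and t: "0 < t"
    and min: "is_arg_min (\<lambda>v. \<phi> v + 1 / t * bregman d d' v u) (\<lambda>v. v \<in> S) p"
    and v: "v \<in> S"
  shows "\<phi> p - \<phi> v \<le> 1 / t * (bregman d d' v u - bregman d d' v p - bregman d d' p u)"
proof -
  have p: "p \<in> S" "\<And>w. w \<in> S \<Longrightarrow>
      \<phi> p + 1 / t * bregman d d' p u \<le> \<phi> w + 1 / t * bregman d d' w u"
    using min by (auto simp: is_arg_min_def not_less)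
  have "t * (\<phi> p - \<phi> v) + d' u \<bullet> (v - p) \<le> d' p \<bullet> (v - p)"
  proof (rule tendsto_lowerbound[OF gradient_on_directional_limit[OF grad S p(1) v]])
    show "\<forall>\<^sub>F s in at_right 0.
        t * (\<phi> p - \<phi> v) + d' u \<bullet> (v - p) \<le> (d (p + s *\<^sub>R (v - p)) - d p) / s"
      using eventually_at_right_0_less_1
    proof eventually_elim
      case (elim s)
      define w where "w = p + s *\<^sub>R (v - p)"
      have w: "w = (1 - s) *\<^sub>R p + s *\<^sub>R v"
        by (simp add: w_def algebra_simps)
      have "w \<in> S"
        unfolding w using convexD[OF S p(1) v] elim by simp
      from mult_left_mono[OF p(2)[OF this], of t]
      have "t * \<phi> p + bregman d d' p u \<le> t * \<phi> w + bregman d d' w u"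
        using t by (simp add: distrib_left)
      moreover have "\<phi> w \<le> (1 - s) * \<phi> p + s * \<phi> v"
        unfolding w using \<phi> p(1) v elim by (auto simp: convex_on_def)
      then have "t * \<phi> w \<le> t * ((1 - s) * \<phi> p + s * \<phi> v)"
        using t by simp
      moreover have "bregman d d' w u - bregman d d' p u = d w - d p - s * (d' u \<bullet> (v - p))"
        by (simp add: bregman_def w_def algebra_simps)
      ultimately have "s * (t * (\<phi> p - \<phi> v) + d' u \<bullet> (v - p)) \<le> d w - d p"
        by (simp add: algebra_simps)
      with elim show ?case
        by (simp add: w_def le_divide_eq mult.commute)
    qed
  qed simp
  also have "d' p \<bullet> (v - p) =
      bregman d d' v u - bregman d d' v p - bregman d d' p u + d' u \<bullet> (v - p)"
    by (simp add: bregman_def algebra_simps)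
  finally show ?thesis
    using t by (simp add: field_simps)
qed

section \<open>One iteration\<close>

text \<open>
  The aggregated primal point and the point where the gradient is taken differ by
  \<open>(xn - xo) / b\<close>, so the smoothness error, multiplied by \<open>b\<close>, still carries a factor
  \<open>1 / b\<close>. The linear part of \<open>G\<close> at that point is split between the old aggregate and the
  comparison point \<open>u\<close>, where it lies below \<open>G\<close> by convexity.
\<close>
lemma saddle_Q_aggregate_step:
  fixes X :: "'a::euclidean_space set" and Y :: "'b::euclidean_space set"
  assumes NX: "is_norm NX" and X: "convex X" and Y: "convex Y"
    and G: "convex_on X G" "gradient_on X G G'"
    and smooth: "\<And>u v. u \<in> X \<Longrightarrow> v \<in> X \<Longrightarrow>
      G v - G u - G' u \<bullet> (v - u) \<le> L / 2 * (NX (v - u))\<^sup>2"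
    and K: "linear K" and J: "convex_on Y J" and b: "1 \<le> b"
    and in_X: "xa \<in> X" "xo \<in> X" "xn \<in> X" "u \<in> X" and in_Y: "ya \<in> Y" "yn \<in> Y"
    and m: "m = (1 - inverse b) *\<^sub>R xa + inverse b *\<^sub>R xo"
    and xa': "xa' = (1 - inverse b) *\<^sub>R xa + inverse b *\<^sub>R xn"
    and ya': "ya' = (1 - inverse b) *\<^sub>R ya + inverse b *\<^sub>R yn"
  shows "b * saddle_Q G K J (xa', ya') (u, v) \<le> (b - 1) * saddle_Q G K J (xa, ya) (u, v)
    + G' m \<bullet> (xn - u) + L / (2 * b) * (NX (xn - xo))\<^sup>2 + J yn - J v + K xn \<bullet> v - K u \<bullet> yn"
proof -
  have c: "0 \<le> 1 - inverse b" "0 \<le> inverse b"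
    using b by (auto simp: inverse_le_1_iff)
  have bb: "b * inverse b = 1" "b * (1 - inverse b) = b - 1"
    using b by (auto simp: algebra_simps)
  have m_in: "m \<in> X" and xa'_in: "xa' \<in> X"
    unfolding m xa' using convexD[OF X] in_X c by auto
  have scale: "b *\<^sub>R xa' = (b - 1) *\<^sub>R xa + xn" "b *\<^sub>R m = (b - 1) *\<^sub>R xa + xo"
    "b *\<^sub>R ya' = (b - 1) *\<^sub>R ya + yn"
    unfolding xa' m ya' by (simp_all only: scaleR_right_distrib scaleR_scaleR bb scaleR_one)
  have "xa' - m = inverse b *\<^sub>R (xn - xo)"
    by (simp add: xa' m algebra_simps)
  then have "NX (xa' - m) = inverse b * NX (xn - xo)"
    using c by (simp only: is_norm_scaleR[OF NX] abs_of_nonneg)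
  then have "b * (L / 2 * (NX (xa' - m))\<^sup>2) = (b * inverse b) * (inverse b * L / 2 * (NX (xn - xo))\<^sup>2)"
    by (simp only: power_mult_distrib) (simp add: power2_eq_square)
  also have "\<dots> = L / (2 * b) * (NX (xn - xo))\<^sup>2"
    by (simp only: bb) (simp add: field_simps)
  finally have "b * (L / 2 * (NX (xa' - m))\<^sup>2) = L / (2 * b) * (NX (xn - xo))\<^sup>2" .
  moreover have "b * (G xa' - G m - G' m \<bullet> (xa' - m)) \<le> b * (L / 2 * (NX (xa' - m))\<^sup>2)"
    using smooth[OF m_in xa'_in] b by (intro mult_left_mono) auto
  ultimately have sm: "b * (G xa' - G m - G' m \<bullet> (xa' - m)) \<le> L / (2 * b) * (NX (xn - xo))\<^sup>2"
    by simp
  have t1: "(b - 1) * (G m + G' m \<bullet> (xa - m)) \<le> (b - 1) * G xa"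
    using convex_above_tangent[OF G(2) X G(1) in_X(1) m_in] b by (intro mult_left_mono) auto
  have t2: "G m + G' m \<bullet> (u - m) \<le> G u"
    by (rule convex_above_tangent[OF G(2) X G(1) in_X(4) m_in])
  have "b *\<^sub>R (xa' - m) = (b - 1) *\<^sub>R (xa - m) + (u - m) + (xn - u)"
    by (simp add: scaleR_right_diff_distrib scale algebra_simps)
  then have "b * (G' m \<bullet> (xa' - m)) =
      (b - 1) * (G' m \<bullet> (xa - m)) + G' m \<bullet> (u - m) + G' m \<bullet> (xn - u)"
    by (metis inner_add_right inner_scaleR_right)
  with sm t1 t2 have Gs: "b * G xa' \<le> (b - 1) * G xa + G u + G' m \<bullet> (xn - u)
      + L / (2 * b) * (NX (xn - xo))\<^sup>2"
    by (simp add: algebra_simps)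
  have "J ya' \<le> (1 - inverse b) * J ya + inverse b * J yn"
    unfolding ya' using J in_Y c by (auto simp: convex_on_def)
  then have "b * J ya' \<le> b * ((1 - inverse b) * J ya + inverse b * J yn)"
    using b by (intro mult_left_mono) auto
  also have "\<dots> = (b - 1) * J ya + J yn"
    by (simp only: distrib_left mult.assoc[symmetric] bb mult_1)
  finally have Js: "b * J ya' \<le> (b - 1) * J ya + J yn" .
  have "b * (K xa' \<bullet> v) = K (b *\<^sub>R xa') \<bullet> v"
    by (simp add: linear_scale[OF K])
  also have "\<dots> = (b - 1) * (K xa \<bullet> v) + K xn \<bullet> v"
    by (simp add: scale linear_add[OF K] linear_scale[OF K] inner_add_left)
  finally have K1: "b * (K xa' \<bullet> v) = (b - 1) * (K xa \<bullet> v) + K xn \<bullet> v" .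
  have "b * (K u \<bullet> ya') = K u \<bullet> (b *\<^sub>R ya')"
    by simp
  also have "\<dots> = (b - 1) * (K u \<bullet> ya) + K u \<bullet> yn"
    by (simp add: scale inner_add_right)
  finally have K2: "b * (K u \<bullet> ya') = (b - 1) * (K u \<bullet> ya) + K u \<bullet> yn" .
  show ?thesis
    using Gs Js K1 K2 by (simp add: saddle_Q_def algebra_simps)
qed

section \<open>The rate of convergence of the gap\<close>

theorem theorem2p1:
  fixes X :: "'a::euclidean_space set" and Y :: "'b::euclidean_space set"
    and NX :: "'a \<Rightarrow> real" and NY :: "'b \<Rightarrow> real"
    and G :: "'a \<Rightarrow> real" and G' :: "'a \<Rightarrow> 'a"
    and K :: "'a \<Rightarrow> 'b" and J :: "'b \<Rightarrow> real"
    and dX :: "'a \<Rightarrow> real" and dX' :: "'a \<Rightarrow> 'a"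
    and dY :: "'b \<Rightarrow> real" and dY' :: "'b \<Rightarrow> 'b"
    and L\<^sub>G L\<^sub>K \<alpha>\<^sub>X \<alpha>\<^sub>Y \<Omega>\<^sub>X \<Omega>\<^sub>Y :: real
    and \<beta> \<theta> \<eta> \<tau> :: "nat \<Rightarrow> real"
    and x xag xmd xbar :: "nat \<Rightarrow> 'a" and y yag :: "nat \<Rightarrow> 'b"
  assumes norms: "is_norm NX" "is_norm NY"
    and X: "closed X" "convex X"
    and Y: "closed Y" "convex Y"
    and G: "convex_on X G" "gradient_on X G G'"
    and LG: "0 \<le> L\<^sub>G"
      "\<And>u v. u \<in> X \<Longrightarrow> v \<in> X \<Longrightarrow> G v - G u - G' u \<bullet> (v - u) \<le> L\<^sub>G / 2 * (NX (v - u))\<^sup>2"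
    and K: "linear K" "L\<^sub>K = induced_norm NX NY K"
    and J: "proper_convex_lsc_on Y J"
    and dX: "0 < \<alpha>\<^sub>X" "strongly_convex_on \<alpha>\<^sub>X NX X dX" "gradient_on X dX dX'"
    and dY: "0 < \<alpha>\<^sub>Y" "strongly_convex_on \<alpha>\<^sub>Y NY Y dY" "gradient_on Y dY dY'"
    and \<Omega>_pos: "0 < \<Omega>\<^sub>X" "0 < \<Omega>\<^sub>Y"
    and \<Omega>\<^sub>X: "(SUP (u, v)\<in>X \<times> X. ereal (bregman dX dX' u v)) \<le> ereal (\<Omega>\<^sub>X\<^sup>2)"
    and \<Omega>\<^sub>Y: "(SUP (u, v)\<in>Y \<times> Y. ereal (bregman dY dY' u v)) \<le> ereal (\<Omega>\<^sub>Y\<^sup>2)"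
    \<comment> \<open>the APD algorithm\<close>
    and start: "x 1 \<in> X" "y 1 \<in> Y" "xag 1 = x 1" "yag 1 = y 1" "xbar 1 = x 1"
    and stepsizes: "\<And>t. t \<ge> 1 \<Longrightarrow> 0 < \<eta> t \<and> 0 < \<tau> t"
    and xmd: "\<And>t. t \<ge> 1 \<Longrightarrow> xmd t = (1 - inverse (\<beta> t)) *\<^sub>R xag t + inverse (\<beta> t) *\<^sub>R x t"
    and y_step: "\<And>t. t \<ge> 1 \<Longrightarrow>
      is_arg_min (\<lambda>v. (- K (xbar t)) \<bullet> v + J v + 1 / \<tau> t * bregman dY dY' v (y t))
        (\<lambda>v. v \<in> Y) (y (t + 1))"
    and x_step: "\<And>t. t \<ge> 1 \<Longrightarrow>
      is_arg_min (\<lambda>u. G' (xmd t) \<bullet> u + u \<bullet> adjoint K (y (t + 1)) + 1 / \<eta> t * bregman dX dX' u (x t))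
        (\<lambda>u. u \<in> X) (x (t + 1))"
    and xag: "\<And>t. t \<ge> 1 \<Longrightarrow>
      xag (t + 1) = (1 - inverse (\<beta> t)) *\<^sub>R xag t + inverse (\<beta> t) *\<^sub>R x (t + 1)"
    and yag: "\<And>t. t \<ge> 1 \<Longrightarrow>
      yag (t + 1) = (1 - inverse (\<beta> t)) *\<^sub>R yag t + inverse (\<beta> t) *\<^sub>R y (t + 1)"
    and xbar: "\<And>t. t \<ge> 1 \<Longrightarrow> xbar (t + 1) = \<theta> (t + 1) *\<^sub>R (x (t + 1) - x t) + x (t + 1)"
    \<comment> \<open>the conditions on the parameters\<close>
    and \<beta>: "\<beta> 1 = 1" "\<And>t. t \<ge> 1 \<Longrightarrow> \<beta> (t + 1) - 1 = \<beta> t * \<theta> (t + 1)"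
    and \<theta>: "\<And>t. t \<ge> 2 \<Longrightarrow>
      0 < \<theta> t \<and> \<theta> t \<le> min (\<eta> (t - 1) / \<eta> t) (\<tau> (t - 1) / \<tau> t)"
    and params: "\<And>t. t \<ge> 1 \<Longrightarrow> \<alpha>\<^sub>X / \<eta> t - L\<^sub>G / \<beta> t - L\<^sub>K\<^sup>2 * \<tau> t / \<alpha>\<^sub>Y \<ge> 0"
  shows "\<forall>t\<ge>1. gap X Y G K J (xag (t + 1), yag (t + 1)) \<le>
    ereal (1 / (\<beta> t * \<eta> t) * \<Omega>\<^sub>X\<^sup>2 + 1 / (\<beta> t * \<tau> t) * \<Omega>\<^sub>Y\<^sup>2)"
proof -
  have \<beta>_ge: "1 \<le> \<beta> t" if "t \<ge> 1" for t
    using that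
  proof (induction t rule: nat_induct_at_least)
    case (Suc n)
    have "0 \<le> \<beta> n * \<theta> (n + 1)"
      using Suc \<theta>[of "n + 1"] by simp
    then show ?case
      using \<beta>(2)[OF Suc.hyps] by simp
  qed (use \<beta>(1) in simp)
  have J_conv: "convex_on Y J"
    using J by (simp add: proper_convex_lsc_on_def)
  have adj: "u \<bullet> adjoint K w = K u \<bullet> w" for u w
    by (simp add: adjoint_works[OF K(1)])
  have VX_le: "bregman dX dX' u v \<le> \<Omega>\<^sub>X\<^sup>2" if "u \<in> X" "v \<in> X" for u v
    using \<Omega>\<^sub>X that by (auto simp: SUP_le_iff)
  have VY_le: "bregman dY dY' u v \<le> \<Omega>\<^sub>Y\<^sup>2" if "u \<in> Y" "v \<in> Y" for u v
    using \<Omega>\<^sub>Y that by (auto simp: SUP_le_iff)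
  have x_in: "x t \<in> X" if "t \<ge> 1" for t
    using that start(1) x_step by (induction t rule: nat_induct_at_least) (auto simp: is_arg_min_def)
  have y_in: "y t \<in> Y" if "t \<ge> 1" for t
    using that start(2) y_step by (induction t rule: nat_induct_at_least) (auto simp: is_arg_min_def)
  have ag_in: "xag t \<in> X \<and> yag t \<in> Y" if "t \<ge> 1" for t
    using that
  proof (induction t rule: nat_induct_at_least)
    case (Suc n)
    have "0 \<le> 1 - inverse (\<beta> n)" "0 \<le> inverse (\<beta> n)"
      using \<beta>_ge[OF Suc.hyps] by (auto simp: inverse_le_1_iff)
    then show ?case
      using Suc x_in[of "Suc n"] y_in[of "Suc n"] xag[OF Suc.hyps] yag[OF Suc.hyps]
        convexD[OF X(2)] convexD[OF Y(2)] by simp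
  qed (use start in auto)
  have bound: "saddle_Q G K J (xag (t + 1), yag (t + 1)) (u, v) \<le>
      1 / (\<beta> t * \<eta> t) * \<Omega>\<^sub>X\<^sup>2 + 1 / (\<beta> t * \<tau> t) * \<Omega>\<^sub>Y\<^sup>2"
    if uv: "u \<in> X" "v \<in> Y" and t: "t \<ge> 1" for u v t
  proof -
    define Q where "Q t = saddle_Q G K J (xag t, yag t) (u, v)" for t
    define A where "A t = \<Omega>\<^sub>X\<^sup>2 - bregman dX dX' u (x t)" for t
    define B where "B t = \<Omega>\<^sub>Y\<^sup>2 - bregman dY dY' v (y t)" for t
    define C where "C t = K (x (t + 1) - x t) \<bullet> (y (t + 1) - v)" for t
    define D where "D t = (NX (x (t + 1) - x t))\<^sup>2" for t
    define E where "E t = (NY (y (t + 1) - y t))\<^sup>2" for t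
    have A_nonneg: "0 \<le> A t" and B_nonneg: "0 \<le> B t" if "t \<ge> 1" for t
      using VX_le VY_le uv x_in y_in that by (auto simp: A_def B_def)
    have D_nonneg: "0 \<le> D t" for t
      by (simp add: D_def)
    have step: "\<beta> t * Q (t + 1) \<le> (\<beta> t - 1) * Q t
        + (A (t + 1) - A t) / \<eta> t + (B (t + 1) - B t) / \<tau> t
        - K (x (t + 1) - xbar t) \<bullet> (y (t + 1) - v)
        - (\<alpha>\<^sub>X / (2 * \<eta> t) - L\<^sub>G / (2 * \<beta> t)) * D t - \<alpha>\<^sub>Y / (2 * \<tau> t) * E t" if t: "t \<ge> 1" for t
    proof -
      have pos: "0 < \<eta> t" "0 < \<tau> t"
        using stepsizes[OF t] by auto
      have ins: "x t \<in> X" "x (t + 1) \<in> X" "y t \<in> Y" "y (t + 1) \<in> Y" "xag t \<in> X" "yag t \<in> Y"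
        using x_in[of t] x_in[of "t + 1"] y_in[of t] y_in[of "t + 1"] ag_in[of t] t by auto
      have 1: "\<beta> t * Q (t + 1) \<le> (\<beta> t - 1) * Q t + G' (xmd t) \<bullet> (x (t + 1) - u)
          + L\<^sub>G / (2 * \<beta> t) * D t + J (y (t + 1)) - J v + K (x (t + 1)) \<bullet> v - K u \<bullet> y (t + 1)"
        unfolding Q_def D_def
        by (rule saddle_Q_aggregate_step[OF norms(1) X(2) Y(2) G LG(2) K(1) J_conv \<beta>_ge[OF t]
              ins(5,1,2) uv(1) ins(6,4) xmd[OF t] xag[OF t] yag[OF t]])
      have lin: "convex_on S (\<lambda>w. a \<bullet> w)" if "convex S" for S :: "'c::real_inner set" and a
        using that by (intro convex_onI) (auto simp: inner_add_right)
      have "convex_on X (\<lambda>w. G' (xmd t) \<bullet> w + w \<bullet> adjoint K (y (t + 1)))"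
        using lin[OF X(2), of "adjoint K (y (t + 1))"]
        by (intro convex_on_add lin X) (simp add: inner_commute)
      from prox_three_point[OF dX(3) X(2) this pos(1) x_step[OF t] uv(1)]
      have 2: "G' (xmd t) \<bullet> (x (t + 1) - u) + K (x (t + 1) - u) \<bullet> y (t + 1) \<le>
          (A (t + 1) - A t) / \<eta> t - bregman dX dX' (x (t + 1)) (x t) / \<eta> t"
        by (simp add: A_def adj linear_diff[OF K(1)] algebra_simps diff_divide_distrib)
      have "convex_on Y (\<lambda>w. (- K (xbar t)) \<bullet> w + J w)"
        by (intro convex_on_add lin Y J_conv)
      from prox_three_point[OF dY(3) Y(2) this pos(2) y_step[OF t] uv(2)]
      have 3: "- K (xbar t) \<bullet> (y (t + 1) - v) + J (y (t + 1)) - J v \<le>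
          (B (t + 1) - B t) / \<tau> t - bregman dY dY' (y (t + 1)) (y t) / \<tau> t"
        by (simp add: B_def algebra_simps diff_divide_distrib)
      have "\<alpha>\<^sub>X / 2 * D t / \<eta> t \<le> bregman dX dX' (x (t + 1)) (x t) / \<eta> t"
        using strongly_convex_bregman_ge[OF dX(3,2) ins(2,1)] pos
        by (intro divide_right_mono) (auto simp: D_def)
      then have 4: "\<alpha>\<^sub>X / (2 * \<eta> t) * D t \<le> bregman dX dX' (x (t + 1)) (x t) / \<eta> t"
        by simp
      have "\<alpha>\<^sub>Y / 2 * E t / \<tau> t \<le> bregman dY dY' (y (t + 1)) (y t) / \<tau> t"
        using strongly_convex_bregman_ge[OF dY(3,2) ins(4,3)] pos
        by (intro divide_right_mono) (auto simp: E_def)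
      then have 5: "\<alpha>\<^sub>Y / (2 * \<tau> t) * E t \<le> bregman dY dY' (y (t + 1)) (y t) / \<tau> t"
        by simp
      \<comment> \<open>The dual step sees \<open>xbar t\<close> in place of \<open>x (t + 1)\<close>, which leaves the last product.\<close>
      have 6: "K (x (t + 1)) \<bullet> v - K u \<bullet> y (t + 1) =
          K (x (t + 1) - u) \<bullet> y (t + 1) - K (xbar t) \<bullet> (y (t + 1) - v)
          - K (x (t + 1) - xbar t) \<bullet> (y (t + 1) - v)"
        by (simp add: linear_diff[OF K(1)] inner_diff_left inner_diff_right)
      have 7: "(\<alpha>\<^sub>X / (2 * \<eta> t) - L\<^sub>G / (2 * \<beta> t)) * D t =
          \<alpha>\<^sub>X / (2 * \<eta> t) * D t - L\<^sub>G / (2 * \<beta> t) * D t"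
        by (rule left_diff_distrib)
      show ?thesis
        using 1 2 3 4 5 6 7 by simp
    qed
    \<comment> \<open>The potentials \<open>A\<close> and \<open>B\<close> are measured from \<open>\<Omega>\<^sub>X\<^sup>2\<close> and \<open>\<Omega>\<^sub>Y\<^sup>2\<close>, hence nonnegative.
      As \<open>\<theta>\<close> is at most the ratio of consecutive stepsizes, multiplying by it then turns
      the old stepsize into the new one, and the differences in the one-step bound telescope.\<close>
    have invariant: "\<beta> t * Q (t + 1) \<le> A (t + 1) / \<eta> t + B (t + 1) / \<tau> t - C t
        - (\<alpha>\<^sub>X / (2 * \<eta> t) - L\<^sub>G / (2 * \<beta> t)) * D t" if "t \<ge> 1" for t
      using that
    proof (induction t rule: nat_induct_at_least)
      case base
      have pos: "0 < \<eta> 1" "0 < \<tau> 1"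
        using stepsizes[of 1] by auto
      have "0 \<le> A 1 / \<eta> 1" "0 \<le> B 1 / \<tau> 1" "0 \<le> \<alpha>\<^sub>Y / (2 * \<tau> 1) * E 1"
        using A_nonneg[of 1] B_nonneg[of 1] pos dY(1) by (auto simp: E_def)
      then show ?case
        using step[of 1] \<beta>(1) start(5) by (simp add: C_def diff_divide_distrib)
    next
      case (Suc n)
      define th where "th = \<theta> (n + 1)"
      have n: "n \<ge> 1" "n + 1 \<ge> 1"
        using Suc.hyps by auto
      have pos: "0 < \<eta> n" "0 < \<tau> n" "0 < \<eta> (n + 1)" "0 < \<tau> (n + 1)"
        using stepsizes n by auto
      have th: "0 < th" "th \<le> \<eta> n / \<eta> (n + 1)" "th \<le> \<tau> n / \<tau> (n + 1)"
        using \<theta>[of "n + 1"] n by (auto simp: th_def)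
      have "th * \<eta> (n + 1) \<le> \<eta> n"
        using th(2) pos by (simp add: le_divide_eq)
      then have thA: "th * (A (n + 1) / \<eta> n) \<le> A (n + 1) / \<eta> (n + 1)"
        using A_nonneg[OF n(2)] pos mult_right_mono[of "th * \<eta> (n + 1)" "\<eta> n" "A (n + 1)"]
        by (simp add: field_simps)
      have th\<tau>: "th * \<tau> (n + 1) \<le> \<tau> n"
        using th(3) pos by (simp add: le_divide_eq)
      then have thB: "th * (B (n + 1) / \<tau> n) \<le> B (n + 1) / \<tau> (n + 1)"
        using B_nonneg[OF n(2)] pos mult_right_mono[of "th * \<tau> (n + 1)" "\<tau> n" "B (n + 1)"]
        by (simp add: field_simps)
      have "xbar (n + 1) = th *\<^sub>R (x (n + 1) - x n) + x (n + 1)"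
        using xbar[OF n(1)] by (simp add: th_def)
      then have "K (xbar (n + 1)) = th *\<^sub>R (K (x (n + 1)) - K (x n)) + K (x (n + 1))"
        by (simp only: linear_diff[OF K(1)] linear_add[OF K(1)] linear_scale[OF K(1)])
      then have coupling: "K (x (n + 2) - xbar (n + 1)) \<bullet> (y (n + 2) - v) =
          C (n + 1) - th * C n - th * (K (x (n + 1) - x n) \<bullet> (y (n + 2) - y (n + 1)))"
        by (simp add: C_def linear_diff[OF K(1)] inner_add_left inner_diff_left inner_diff_right
            right_diff_distrib)
      have recur: "(\<beta> (n + 1) - 1) * Q (n + 1) = th * (\<beta> n * Q (n + 1))"
        using \<beta>(2)[OF n(1)] by (simp add: th_def)
      have young: "th * (K (x (n + 1) - x n) \<bullet> (y (n + 2) - y (n + 1))) \<le>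
          th\<^sup>2 * (L\<^sub>K\<^sup>2 * \<tau> (n + 1) / (2 * \<alpha>\<^sub>Y)) * D n + \<alpha>\<^sub>Y / (2 * \<tau> (n + 1)) * E (n + 1)"
        using coupling_young[OF norms K(1) dY(1) pos(4)] by (simp add: K(2) D_def E_def)
      have "th\<^sup>2 * (L\<^sub>K\<^sup>2 * \<tau> (n + 1) / (2 * \<alpha>\<^sub>Y)) = th * (th * \<tau> (n + 1)) * (L\<^sub>K\<^sup>2 / (2 * \<alpha>\<^sub>Y))"
        by (simp add: power2_eq_square)
      also have "\<dots> \<le> th * \<tau> n * (L\<^sub>K\<^sup>2 / (2 * \<alpha>\<^sub>Y))"
        using th\<tau> th(1) dY(1) by (intro mult_right_mono mult_left_mono) auto
      also have "\<dots> \<le> th * (\<alpha>\<^sub>X / (2 * \<eta> n) - L\<^sub>G / (2 * \<beta> n))"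
      proof -
        have "\<tau> n * (L\<^sub>K\<^sup>2 / (2 * \<alpha>\<^sub>Y)) = (L\<^sub>K\<^sup>2 * \<tau> n / \<alpha>\<^sub>Y) / 2"
          by (simp add: mult.commute)
        also have "\<dots> \<le> (\<alpha>\<^sub>X / \<eta> n - L\<^sub>G / \<beta> n) / 2"
          using params[OF n(1)] by simp
        also have "\<dots> = \<alpha>\<^sub>X / (2 * \<eta> n) - L\<^sub>G / (2 * \<beta> n)"
          by (simp add: diff_divide_distrib)
        finally show ?thesis
          using th(1) by (simp only: mult.assoc mult_left_mono less_imp_le)
      qed
      finally have "th\<^sup>2 * (L\<^sub>K\<^sup>2 * \<tau> (n + 1) / (2 * \<alpha>\<^sub>Y)) \<le>
          th * (\<alpha>\<^sub>X / (2 * \<eta> n) - L\<^sub>G / (2 * \<beta> n))" .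
      from mult_right_mono[OF this D_nonneg[of n]]
      have "th\<^sup>2 * (L\<^sub>K\<^sup>2 * \<tau> (n + 1) / (2 * \<alpha>\<^sub>Y)) * D n \<le>
          th * ((\<alpha>\<^sub>X / (2 * \<eta> n) - L\<^sub>G / (2 * \<beta> n)) * D n)"
        by (simp only: mult.assoc)
      moreover have "th * (\<beta> n * Q (n + 1)) \<le> th * (A (n + 1) / \<eta> n + B (n + 1) / \<tau> n - C n
          - (\<alpha>\<^sub>X / (2 * \<eta> n) - L\<^sub>G / (2 * \<beta> n)) * D n)"
        using Suc.IH th(1) by (intro mult_left_mono) auto
      ultimately show ?case
        using step[OF n(2), unfolded recur] thA thB coupling young
        by (simp add: diff_divide_distrib distrib_left right_diff_distrib)
    qed
    have pos: "0 < \<eta> t" "0 < \<tau> t" "0 < \<beta> t"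
      using stepsizes[OF t] \<beta>_ge[OF t] by auto
    have ins: "x (t + 1) \<in> X" "y (t + 1) \<in> Y"
      using x_in y_in t by auto
    have "- C t \<le> L\<^sub>K\<^sup>2 * \<tau> t / (2 * \<alpha>\<^sub>Y) * D t + \<alpha>\<^sub>Y / (2 * \<tau> t) * (NY (v - y (t + 1)))\<^sup>2"
      using coupling_young[OF norms K(1) dY(1) pos(2), of 1 "x (t + 1) - x t" "v - y (t + 1)"]
      by (simp add: K(2) C_def D_def inner_diff_right)
    moreover have "L\<^sub>K\<^sup>2 * \<tau> t / (2 * \<alpha>\<^sub>Y) * D t \<le> (\<alpha>\<^sub>X / (2 * \<eta> t) - L\<^sub>G / (2 * \<beta> t)) * D t"
      using params[OF t] by (intro mult_right_mono D_nonneg) simp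
    moreover have "\<alpha>\<^sub>Y / (2 * \<tau> t) * (NY (v - y (t + 1)))\<^sup>2 \<le> \<Omega>\<^sub>Y\<^sup>2 / \<tau> t - B (t + 1) / \<tau> t"
      using divide_right_mono[OF strongly_convex_bregman_ge[OF dY(3,2) uv(2) ins(2)], of "\<tau> t"] pos
      by (simp add: B_def diff_divide_distrib)
    moreover have "A (t + 1) / \<eta> t \<le> \<Omega>\<^sub>X\<^sup>2 / \<eta> t"
    proof -
      have "0 \<le> \<alpha>\<^sub>X / 2 * (NX (u - x (t + 1)))\<^sup>2"
        using dX(1) by simp
      also have "\<dots> \<le> bregman dX dX' u (x (t + 1))"
        by (rule strongly_convex_bregman_ge[OF dX(3,2) uv(1) ins(1)])
      finally show ?thesis
        using pos by (intro divide_right_mono) (auto simp: A_def)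
    qed
    ultimately have "\<beta> t * Q (t + 1) \<le> \<Omega>\<^sub>X\<^sup>2 / \<eta> t + \<Omega>\<^sub>Y\<^sup>2 / \<tau> t"
      using invariant[OF t] by linarith
    then have "Q (t + 1) \<le> (\<Omega>\<^sub>X\<^sup>2 / \<eta> t + \<Omega>\<^sub>Y\<^sup>2 / \<tau> t) / \<beta> t"
      using pos by (simp add: le_divide_eq mult.commute)
    then show ?thesis
      by (simp add: Q_def add_divide_distrib mult.commute)
  qed
  then show ?thesis
    unfolding gap_def by (auto intro!: SUP_least)
qed

end
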